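(* Let $T=(V,E)$ be a tournament on $n$ vertices, and let $c(T,5)$ be the number of directed 5-cycles in $T$. Then $$c(T,5) = \frac{3}{4}\binom{n}{5} - \frac{1}{8}\sum_{(u,v)\in E} \left[(C+D)(A-B)^2 + (A+B)(C-D)^2\right] + \frac{1}{4}\sum_{(u,v)\in E} (A+B)(C+D),$$ where, inside each sum, $A=A(u,v)$, $B=B(u,v)$, $C=C(u,v)$, $D=D(u,v)$ are the edge scores of the edge $(u,v)$.
   Context: A tournament $T=(V,E)$ on $n$ vertices (an $n$-tournament) is a directed graph with $|V|=n$, without loops, such that for every pair of distinct vertices $u,v$ exactly one of $(u,v),(v,u)$ lies in $E$. The quantity $c(T,k)$ is the number of directed $k$-cycles of $T$, counted as subgraphs (i.e. cyclic rotations of the same vertex sequence give the same cycle). For an edge $(u,v)\in E$ the edge scores are: $A(u,v) = |\{w\in V\setminus\{u,v\} : (u,w)\in E \text{ and } (v,w)\in E\}|$; $B(u,v) = |\{w\in V\setminus\{u,v\} : (w,u)\in E \text{ and } (w,v)\in E\}|$; $C(u,v) = |\{w\in V\setminus\{u,v\} : (u,w)\in E \text{ and } (w,v)\in E\}|$; $D(u,v) = |\{w\in V\setminus\{u,v\} : (w,u)\in E \text{ and } (v,w)\in E\}|$. *)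

theory Defs
  imports Complex_Main "Graph_Theory.Pair_Digraph"
begin

locale tournament = pair_digraph T for T :: "'a pair_pre_digraph" +
  assumes exactly_one_arc:
    "u \<in> pverts T \<Longrightarrow> v \<in> pverts T \<Longrightarrow> u \<noteq> v \<Longrightarrow> (u, v) \<in> parcs T \<longleftrightarrow> (v, u) \<notin> parcs T"

(* The library's cycles are lists of arcs with a distinguished starting point.  Passing to the
   subgraph formed by the arcs identifies exactly the cyclic rotations of a cycle. *)
definition cycle_subgraphs :: "'a pair_pre_digraph \<Rightarrow> nat \<Rightarrow> 'a pair_pre_digraph set" where
  "cycle_subgraphs T k =
    {\<lparr>pverts = fst ` set p, parcs = set p\<rparr> | p. pre_digraph.cycle (with_proj T) p \<and> length p = k}"

definition num_cycles :: "'a pair_pre_digraph \<Rightarrow> nat \<Rightarrow> nat" where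
  "num_cycles T k = card (cycle_subgraphs T k)"

definition edge_score_A :: "'a pair_pre_digraph \<Rightarrow> 'a \<Rightarrow> 'a \<Rightarrow> nat" where
  "edge_score_A T u v = card {w \<in> pverts T - {u, v}. (u, w) \<in> parcs T \<and> (v, w) \<in> parcs T}"

definition edge_score_B :: "'a pair_pre_digraph \<Rightarrow> 'a \<Rightarrow> 'a \<Rightarrow> nat" where
  "edge_score_B T u v = card {w \<in> pverts T - {u, v}. (w, u) \<in> parcs T \<and> (w, v) \<in> parcs T}"

definition edge_score_C :: "'a pair_pre_digraph \<Rightarrow> 'a \<Rightarrow> 'a \<Rightarrow> nat" where
  "edge_score_C T u v = card {w \<in> pverts T - {u, v}. (u, w) \<in> parcs T \<and> (w, v) \<in> parcs T}"

definition edge_score_D :: "'a pair_pre_digraph \<Rightarrow> 'a \<Rightarrow> 'a \<Rightarrow> nat" where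
  "edge_score_D T u v = card {w \<in> pverts T - {u, v}. (w, u) \<in> parcs T \<and> (v, w) \<in> parcs T}"

end

theory Submission
  imports Defs
begin

text \<open>
  Encode each arc by a sign \<open>s x y = 1\<close> or \<open>- 1\<close>, antisymmetric in \<open>x, y\<close>. Expanding the
  indicator \<open>\<Prod> (1 + s) / 2\<close> of a 5-cycle and summing over all injective 5-tuples, the odd terms
  cancel under reversal and the products of two disjoint arcs cancel under a swap; what remains is a
  constant plus the sums of \<open>s a b * s b c\<close> and of \<open>s a b * s b c * s c d * s d e\<close>. On the other side,
  \<open>A \<plusminus> B\<close> and \<open>C \<plusminus> D\<close> are sums over a third vertex \<open>w\<close> of polynomials in \<open>s u w\<close> and \<open>s v w\<close>. The
  correction \<open>(A + B) * (C + D)\<close> removes exactly the coincident vertices from the cubic edge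
  terms, which thereby become sums over injective 5-tuples and reduce to the same two path sums.
\<close>

section \<open>Injective 5-tuples: counting them and permuting their entries under a sum\<close>

definition tuples5 :: "'a set \<Rightarrow> ('a \<times> 'a \<times> 'a \<times> 'a \<times> 'a) set" where
  "tuples5 V = {(a, b, c, d, e). {a, b, c, d, e} \<subseteq> V \<and> distinct [a, b, c, d, e]}"

lemma tuples5_eq_Sigma:
  "tuples5 V = (SIGMA a:V. SIGMA b:V-{a}. SIGMA c:V-{a,b}. SIGMA d:V-{a,b,c}. V-{a,b,c,d})"
  unfolding tuples5_def by auto

lemma finite_tuples5: "finite V \<Longrightarrow> finite (tuples5 V)"
  unfolding tuples5_eq_Sigma by (intro finite_SigmaI) auto

lemma sum_tuples5:
  assumes "finite V"
  shows "(\<Sum>(a, b, c, d, e)\<in>tuples5 V. f a b c d e) =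
    (\<Sum>a\<in>V. \<Sum>b\<in>V-{a}. \<Sum>c\<in>V-{a,b}. \<Sum>d\<in>V-{a,b,c}. \<Sum>e\<in>V-{a,b,c,d}. f a b c d e)"
  unfolding tuples5_eq_Sigma using assms by (simp add: sum.Sigma)

lemma card_tuples5:
  assumes "finite V"
  shows "card (tuples5 V) = 120 * (card V choose 5)"
proof -
  have 1: "card (V - {a}) = card V - 1" if "a \<in> V" for a
    using that assms by simp
  have 2: "card (V - {a,b}) = card V - 2" if "a \<in> V" "b \<in> V - {a}" for a b
    using that assms by (subst card_Diff_subset) auto
  have 3: "card (V - {a,b,c}) = card V - 3" if "a \<in> V" "b \<in> V - {a}" "c \<in> V - {a,b}" for a b c
    using that assms by (subst card_Diff_subset) auto
  have 4: "card (V - {a,b,c,d}) = card V - 4"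
    if "a \<in> V" "b \<in> V - {a}" "c \<in> V - {a,b}" "d \<in> V - {a,b,c}" for a b c d
    using that assms by (subst card_Diff_subset) auto
  have "card (tuples5 V) = (\<Sum>(a, b, c, d, e)\<in>tuples5 V. 1)"
    by (simp add: case_prod_unfold)
  also have "\<dots> = (\<Sum>a\<in>V. \<Sum>b\<in>V-{a}. \<Sum>c\<in>V-{a,b}. \<Sum>d\<in>V-{a,b,c}. card V - 4)"
    unfolding sum_tuples5[OF assms] by (intro sum.cong refl) (simp only: sum_constant 4 mult_1_right of_nat_id)
  also have "\<dots> = (\<Sum>a\<in>V. \<Sum>b\<in>V-{a}. \<Sum>c\<in>V-{a,b}. (card V - 3) * (card V - 4))"
    by (intro sum.cong refl) (simp only: sum_constant 3 of_nat_id)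
  also have "\<dots> = (\<Sum>a\<in>V. \<Sum>b\<in>V-{a}. (card V - 2) * ((card V - 3) * (card V - 4)))"
    by (intro sum.cong refl) (simp only: sum_constant 2 of_nat_id)
  also have "\<dots> = (\<Sum>a\<in>V. (card V - 1) * ((card V - 2) * ((card V - 3) * (card V - 4))))"
    by (intro sum.cong refl) (simp only: sum_constant 1 of_nat_id)
  also have "\<dots> = card V * ((card V - 1) * ((card V - 2) * ((card V - 3) * (card V - 4))))"
    by simp
  also have "\<dots> = 120 * (card V choose 5)"
  proof -
    \<comment> \<open>Repeated absorption
      \<open>k * (m choose k) = m * (m - 1 choose (k - 1))\<close>, from the innermost factor
      outwards, accumulates the constants 2, 6, 24, 120. Truncated subtraction does no harm: for
      fewer than five vertices both sides are 0.\<close>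
    have "card V - 4 = (card V - 4) choose 1" by simp
    also have "(card V - 3) * \<dots> = 2 * (card V - 3 choose 2)"
      using times_binomial_minus1_eq[of 2 "card V - 3"] by simp
    also have "(card V - 2) * \<dots> = 6 * (card V - 2 choose 3)"
      using times_binomial_minus1_eq[of 3 "card V - 2"] by simp
    also have "(card V - 1) * \<dots> = 24 * (card V - 1 choose 4)"
      using times_binomial_minus1_eq[of 4 "card V - 1"] by (simp add: numeral_2_eq_2)
    also have "card V * \<dots> = 120 * (card V choose 5)"
      using times_binomial_minus1_eq[of 5 "card V"] by simp
    finally show ?thesis .
  qed
  finally show ?thesis .
qed

lemma sum_tuples5_rotate:
  "(\<Sum>(a, b, c, d, e)\<in>tuples5 V. f a b c d e) = (\<Sum>(a, b, c, d, e)\<in>tuples5 V. f b c d e a)"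
  by (rule sum.reindex_bij_witness[where i = "\<lambda>(a, b, c, d, e). (b, c, d, e, a)"
        and j = "\<lambda>(a, b, c, d, e). (e, a, b, c, d)"])
     (auto simp: tuples5_def)

lemma sum_tuples5_swap:
  "(\<Sum>(a, b, c, d, e)\<in>tuples5 V. f a b c d e) = (\<Sum>(a, b, c, d, e)\<in>tuples5 V. f b a c d e)"
  by (rule sum.reindex_bij_witness[where i = "\<lambda>(a, b, c, d, e). (b, a, c, d, e)"
        and j = "\<lambda>(a, b, c, d, e). (b, a, c, d, e)"])
     (auto simp: tuples5_def)

lemma sum_tuples5_reverse:
  "(\<Sum>(a, b, c, d, e)\<in>tuples5 V. f a b c d e) = (\<Sum>(a, b, c, d, e)\<in>tuples5 V. f e d c b a)"
  by (rule sum.reindex_bij_witness[where i = "\<lambda>(a, b, c, d, e). (e, d, c, b, a)"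
        and j = "\<lambda>(a, b, c, d, e). (e, d, c, b, a)"])
     (auto simp: tuples5_def)

text \<open>Since \<open>g y * h y = 0\<close>, the summand already vanishes when \<open>y\<close>
  is \<open>w\<close> or \<open>x\<close>, so \<open>y\<close> may run over all of \<open>W\<close>.
  The only restriction left is that \<open>x\<close> differs from \<open>w\<close>, which removes
  the diagonal from the square of \<open>sum g W\<close>.\<close>

lemma sum_distinct_triples:
  fixes g h :: "'a \<Rightarrow> real"
  assumes "finite W" and gh: "\<And>y. y \<in> W \<Longrightarrow> g y * h y = 0"
  shows "(\<Sum>w\<in>W. \<Sum>x\<in>W-{w}. \<Sum>y\<in>W-{w,x}. g w * g x * h y) =
    ((\<Sum>w\<in>W. g w)\<^sup>2 - (\<Sum>w\<in>W. (g w)\<^sup>2)) * (\<Sum>y\<in>W. h y)"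
proof -
  have "(\<Sum>y\<in>W-{w,x}. g w * g x * h y) = g w * g x * sum h W" if "w \<in> W" "x \<in> W" for w x
  proof -
    have "(\<Sum>y\<in>W-{w,x}. g w * g x * h y) = (\<Sum>y\<in>W. g w * g x * h y)"
      using assms that by (intro sum.mono_neutral_left) auto
    then show ?thesis by (simp add: sum_distrib_left)
  qed
  then have "(\<Sum>w\<in>W. \<Sum>x\<in>W-{w}. \<Sum>y\<in>W-{w,x}. g w * g x * h y)
      = (\<Sum>w\<in>W. \<Sum>x\<in>W-{w}. g w * g x * sum h W)"
    by simp
  also have "\<dots> = (\<Sum>w\<in>W. (g w * sum g W - (g w)\<^sup>2) * sum h W)"
    using assms(1)
    by (intro sum.cong refl)
       (simp add: sum_diff1 power2_eq_square algebra_simps flip: sum_distrib_left sum_distrib_right)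
  also have "\<dots> = ((sum g W)\<^sup>2 - (\<Sum>w\<in>W. (g w)\<^sup>2)) * sum h W"
    by (simp add: sum_subtractf power2_eq_square flip: sum_distrib_left sum_distrib_right)
  finally show ?thesis .
qed

section \<open>Five-cycles as arc sets of tuples, up to rotation\<close>

definition cycle5_arcs :: "'a \<times> 'a \<times> 'a \<times> 'a \<times> 'a \<Rightarrow> ('a \<times> 'a) set" where
  "cycle5_arcs = (\<lambda>(a, b, c, d, e). {(a, b), (b, c), (c, d), (d, e), (e, a)})"

text \<open>Every vertex of the cycle has exactly one successor, so the first entry of
  \<open>t\<close> determines all the others; its five possible values give the five
  rotations.\<close>

lemma cycle5_arcs_eq_iff:
  assumes "distinct [a, b, c, d, e]"
  shows "cycle5_arcs t = cycle5_arcs (a, b, c, d, e) \<longleftrightarrow>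
    t \<in> {(a, b, c, d, e), (b, c, d, e, a), (c, d, e, a, b), (d, e, a, b, c), (e, a, b, c, d)}"
    (is "_ \<longleftrightarrow> t \<in> ?R")
proof
  obtain a' b' c' d' e' where t: "t = (a', b', c', d', e')" by (cases t) auto
  assume "cycle5_arcs t = cycle5_arcs (a, b, c, d, e)"
  then have "cycle5_arcs t \<subseteq> cycle5_arcs (a, b, c, d, e)"
    by (rule equalityD1)
  then have arcs: "(a', b') \<in> cycle5_arcs (a, b, c, d, e)" "(b', c') \<in> cycle5_arcs (a, b, c, d, e)"
    "(c', d') \<in> cycle5_arcs (a, b, c, d, e)" "(d', e') \<in> cycle5_arcs (a, b, c, d, e)"
    unfolding t by (simp_all add: cycle5_arcs_def)
  have succ: "(a, y) \<in> cycle5_arcs (a, b, c, d, e) \<longleftrightarrow> y = b"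
    "(b, y) \<in> cycle5_arcs (a, b, c, d, e) \<longleftrightarrow> y = c"
    "(c, y) \<in> cycle5_arcs (a, b, c, d, e) \<longleftrightarrow> y = d" "(d, y) \<in> cycle5_arcs (a, b, c, d, e) \<longleftrightarrow> y = e"
    "(e, y) \<in> cycle5_arcs (a, b, c, d, e) \<longleftrightarrow> y = a" for y
    using assms by (auto simp: cycle5_arcs_def)
  consider "a' = a" | "a' = b" | "a' = c" | "a' = d" | "a' = e"
    using arcs(1) by (auto simp: cycle5_arcs_def)
  then show "t \<in> ?R"
    by cases (use arcs in \<open>simp_all add: t succ\<close>)
qed (auto simp: cycle5_arcs_def)

context tournament
begin

text \<open>As a difference of two indicators the sign is antisymmetric for all arguments, with
  value 0 on the diagonal; it is 1 or -1 on distinct vertices.\<close>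

definition arc_sign :: "'a \<Rightarrow> 'a \<Rightarrow> real" where
  "arc_sign x y = of_bool ((x, y) \<in> parcs T) - of_bool ((y, x) \<in> parcs T)"

lemma arc_sign_antisym: "arc_sign y x = - arc_sign x y"
  by (simp add: arc_sign_def)

lemma of_bool_arc:
  assumes "x \<in> pverts T" "y \<in> pverts T" "x \<noteq> y"
  shows "of_bool ((x, y) \<in> parcs T) = (1 + arc_sign x y) / 2"
  using exactly_one_arc[OF assms] by (auto simp: arc_sign_def)

text \<open>These are the 5-cycles with a marked starting vertex.\<close>

definition cycles5 :: "('a \<times> 'a \<times> 'a \<times> 'a \<times> 'a) set" where
  "cycles5 = {t \<in> tuples5 (pverts T). cycle5_arcs t \<subseteq> parcs T}"

lemma cycle_length5_iff:
  "cycle p \<and> length p = 5 \<longleftrightarrow>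
    (\<exists>a b c d e. (a, b, c, d, e) \<in> cycles5 \<and> p = [(a, b), (b, c), (c, d), (d, e), (e, a)])"
proof
  assume "cycle p \<and> length p = 5"
  then obtain u where u: "awalk u p u" "distinct (tl (pawalk_verts u p))" and len: "length p = 5"
    by (auto simp: cycle_def)
  obtain p1 p2 p3 p4 p5 where p: "p = [p1, p2, p3, p4, p5]"
    using len by (auto simp: numeral_eq_Suc length_Suc_conv)
  \<comment> \<open>Consecutive arcs of a walk share a vertex, and the walk closes up at
    \<open>u\<close>.\<close>
  obtain b c d e where p': "p = [(u, b), (b, c), (c, d), (d, e), (e, u)]"
    using u(1) unfolding p awalk_def by (metis pcas.simps prod.collapse)
  \<comment> \<open>A closed walk lists \<open>u\<close> at both ends; \<open>tl\<close> drops the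
    first occurrence, hence the order \<open>b, c, d, e, u\<close>.\<close>
  then have arcs: "cycle5_arcs (u, b, c, d, e) \<subseteq> parcs T" and "distinct [b, c, d, e, u]"
    using u by (simp_all add: awalk_def cycle5_arcs_def)
  moreover have "{u, b, c, d, e} \<subseteq> pverts T"
    using arcs in_arcsD1 unfolding cycle5_arcs_def by simp blast
  ultimately have "(u, b, c, d, e) \<in> cycles5"
    by (auto simp: cycles5_def tuples5_def)
  with p' show "\<exists>a b c d e. (a, b, c, d, e) \<in> cycles5 \<and> p = [(a, b), (b, c), (c, d), (d, e), (e, a)]"
    by blast
next
  assume "\<exists>a b c d e. (a, b, c, d, e) \<in> cycles5 \<and> p = [(a, b), (b, c), (c, d), (d, e), (e, a)]"
  then obtain a b c d e where *: "(a, b, c, d, e) \<in> cycles5"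
      "p = [(a, b), (b, c), (c, d), (d, e), (e, a)]"
    by blast
  then have "awalk a p a \<and> distinct (tl (pawalk_verts a p)) \<and> p \<noteq> []"
    by (auto simp: awalk_def cycles5_def tuples5_def cycle5_arcs_def)
  then show "cycle p \<and> length p = 5"
    using * unfolding cycle_def by auto
qed

text \<open>Forgetting the marked start is a map onto the cycle subgraphs whose fibres are the
  classes of five rotations.\<close>

lemma card_cycles5: "card cycles5 = 5 * num_cycles T 5"
proof -
  have fin: "finite cycles5"
    unfolding cycles5_def using finite_tuples5[OF pair_finite_verts] by simp
  let ?G = "\<lambda>A. \<lparr>pverts = fst ` A, parcs = A\<rparr>"
  let ?L = "\<lambda>(a, b, c, d, e). [(a, b), (b, c), (c, d), (d, e), (e, a)]"
  have "cycle_subgraphs T 5 = (\<lambda>p. ?G (set p)) ` {p. cycle p \<and> length p = 5}"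
    unfolding cycle_subgraphs_def by blast
  also have "{p. cycle p \<and> length p = 5} = ?L ` cycles5"
    unfolding cycle_length5_iff by (simp add: image_def Bex_def split_paired_Ex)
  also have "(\<lambda>p. ?G (set p)) ` \<dots> = ?G ` cycle5_arcs ` cycles5"
    unfolding image_image by (intro image_cong refl) (simp add: cycle5_arcs_def case_prod_unfold)
  \<comment> \<open>A subgraph contains its arc set as a field, so \<open>?G\<close> is injective
    and arc sets can be counted instead.\<close>
  finally have num: "num_cycles T 5 = card (cycle5_arcs ` cycles5)"
    unfolding num_cycles_def by (simp add: card_image inj_on_def)
  have fibre: "card {t \<in> cycles5. cycle5_arcs t = A} = 5" if A: "A \<in> cycle5_arcs ` cycles5" for A
  proof -
    obtain s where s: "s \<in> cycles5" "A = cycle5_arcs s"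
      using A by blast
    obtain a b c d e where "s = (a, b, c, d, e)"
      by (cases s)
    with s have t: "(a, b, c, d, e) \<in> cycles5" "A = cycle5_arcs (a, b, c, d, e)"
      by simp_all
    then have dist: "distinct [a, b, c, d, e]"
      by (simp add: cycles5_def tuples5_def)
    let ?R = "{(a, b, c, d, e), (b, c, d, e, a), (c, d, e, a, b), (d, e, a, b, c), (e, a, b, c, d)}"
    have "?R \<subseteq> cycles5"
      using t(1) by (auto simp: cycles5_def tuples5_def cycle5_arcs_def)
    then have "{t \<in> cycles5. cycle5_arcs t = A} = ?R"
      unfolding t(2) cycle5_arcs_eq_iff[OF dist] by blast
    then show ?thesis using dist by simp
  qed
  have "card cycles5 = (\<Sum>A\<in>cycle5_arcs ` cycles5. card {t \<in> cycles5. cycle5_arcs t = A})"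
    using sum.image_gen[OF fin, of "\<lambda>_. 1::nat" cycle5_arcs] by simp
  also have "\<dots> = 5 * num_cycles T 5"
    using fibre by (simp add: num)
  finally show ?thesis .
qed

section \<open>Expansion of the 5-cycle indicator into path sums\<close>

definition path_sum2 :: real where
  "path_sum2 = (\<Sum>(a, b, c, d, e)\<in>tuples5 (pverts T). arc_sign a b * arc_sign b c)"

text \<open>The four arcs form a path through all five entries. \<open>path_sum2\<close> keeps the
  same index set, with \<open>d\<close> and \<open>e\<close> free, so that all terms of the
  expansion are sums over one set.\<close>

definition path_sum4 :: real where
  "path_sum4 = (\<Sum>(a, b, c, d, e)\<in>tuples5 (pverts T).
     arc_sign a b * arc_sign b c * arc_sign c d * arc_sign d e)"

abbreviation tsum :: "('a \<Rightarrow> 'a \<Rightarrow> 'a \<Rightarrow> 'a \<Rightarrow> 'a \<Rightarrow> real) \<Rightarrow> real" where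
  "tsum f \<equiv> (\<Sum>(a, b, c, d, e)\<in>tuples5 (pverts T). f a b c d e)"

lemma tsum_add: "tsum (\<lambda>a b c d e. f a b c d e + g a b c d e) = tsum f + tsum g"
  by (simp add: case_prod_unfold sum.distrib)

lemma tsum_cmult: "tsum (\<lambda>a b c d e. k * f a b c d e) = k * tsum f"
  by (simp add: case_prod_unfold sum_distrib_left)

text \<open>Exchanging \<open>a\<close> and \<open>b\<close> negates the first factor and fixes the
  second, so the sum equals its own negative.\<close>

lemma tsum_disjoint_arcs: "tsum (\<lambda>a b c d e. arc_sign a b * arc_sign c d) = 0"
proof -
  have "tsum (\<lambda>a b c d e. arc_sign a b * arc_sign c d)
      = tsum (\<lambda>a b c d e. arc_sign b a * arc_sign c d)"
    by (rule sum_tuples5_swap)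
  also have "\<dots> = tsum (\<lambda>a b c d e. (-1) * (arc_sign a b * arc_sign c d))"
    by (intro sum.cong refl) (auto simp: arc_sign_def algebra_simps)
  finally show ?thesis unfolding tsum_cmult by simp
qed

lemma tsum_cyclic:
  "tsum (\<lambda>a b c d e. f a b c d e + f b c d e a + f c d e a b + f d e a b c + f e a b c d) = 5 * tsum f"
proof -
  note rot = sum_tuples5_rotate[where V = "pverts T"]
  have "tsum (\<lambda>a b c d e. f b c d e a) = tsum f"
    by (rule rot[symmetric])
  moreover have "tsum (\<lambda>a b c d e. f c d e a b) = tsum (\<lambda>a b c d e. f b c d e a)"
    by (rule rot[symmetric])
  moreover have "tsum (\<lambda>a b c d e. f d e a b c) = tsum (\<lambda>a b c d e. f c d e a b)"
    by (rule rot[symmetric])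
  moreover have "tsum (\<lambda>a b c d e. f e a b c d) = tsum (\<lambda>a b c d e. f d e a b c)"
    by (rule rot[symmetric])
  ultimately show ?thesis
    unfolding tsum_add by linarith
qed

lemma card_cycles5_eq:
  "real (card cycles5) =
    (120 * real (card (pverts T) choose 5) + 5 * path_sum2 + 5 * path_sum4) / 32"
proof -
  define s where "s = arc_sign"
  have anti: "s x y = - s y x" for x y
    unfolding s_def by (rule arc_sign_antisym)
  have "real (card cycles5) = (\<Sum>t\<in>tuples5 (pverts T). of_bool (cycle5_arcs t \<subseteq> parcs T))"
    using finite_tuples5[OF pair_finite_verts]
    by (simp add: cycles5_def sum.If_cases of_bool_def Int_def)
  also have "\<dots> = tsum (\<lambda>a b c d e. (1 + s a b) * (1 + s b c) * (1 + s c d) * (1 + s d e) * (1 + s e a) / 32)"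
    (is "_ = tsum ?f")
  proof (intro sum.cong refl)
    fix t assume "t \<in> tuples5 (pverts T)"
    then obtain a b c d e where t: "t = (a, b, c, d, e)" "{a, b, c, d, e} \<subseteq> pverts T"
        "distinct [a, b, c, d, e]"
      by (auto simp: tuples5_def)
    have "of_bool (cycle5_arcs t \<subseteq> parcs T) =
        of_bool ((a, b) \<in> parcs T) * of_bool ((b, c) \<in> parcs T) * of_bool ((c, d) \<in> parcs T)
        * of_bool ((d, e) \<in> parcs T) * (of_bool ((e, a) \<in> parcs T) :: real)"
      by (simp add: t cycle5_arcs_def flip: of_bool_conj)
    also have "\<dots> = ?f a b c d e"
      using t by (subst (1 2 3 4 5) of_bool_arc) (auto simp: s_def)
    finally show "of_bool (cycle5_arcs t \<subseteq> parcs T) = (case t of (a, b, c, d, e) \<Rightarrow> ?f a b c d e)"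
      by (simp add: t)
  qed
  finally have card: "real (card cycles5) = tsum ?f" .

  \<comment> \<open>Reversing the tuple flips all five signs, so only products of an even number of signs survive.\<close>
  have "2 * tsum ?f = tsum ?f + tsum (\<lambda>a b c d e. ?f e d c b a)"
    using sum_tuples5_reverse[of ?f "pverts T"] by simp
  also have "\<dots> = tsum (\<lambda>a b c d e. ?f a b c d e + ?f e d c b a)"
    by (rule tsum_add[symmetric])
  \<comment> \<open>The surviving products are grouped into rotation orbits: the constant, five
    pairs of adjacent arcs, five pairs of disjoint arcs, and five products omitting one arc.
    Doubling the even part turns 1/32 into 1/16.\<close>
  also have "\<dots> = tsum (\<lambda>a b c d e. (1 / 16) * (1
      + (s a b * s b c + s b c * s c d + s c d * s d e + s d e * s e a + s e a * s a b)
      + (s a b * s c d + s b c * s d e + s c d * s e a + s d e * s a b + s e a * s b c)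
      + (s a b * s b c * s c d * s d e + s b c * s c d * s d e * s e a
       + s c d * s d e * s e a * s a b + s d e * s e a * s a b * s b c
       + s e a * s a b * s b c * s c d)))"
  proof (intro sum.cong refl, clarify)
    fix a b c d e
    show "?f a b c d e + ?f e d c b a = (1 / 16) * (1
      + (s a b * s b c + s b c * s c d + s c d * s d e + s d e * s e a + s e a * s a b)
      + (s a b * s c d + s b c * s d e + s c d * s e a + s d e * s a b + s e a * s b c)
      + (s a b * s b c * s c d * s d e + s b c * s c d * s d e * s e a
       + s c d * s d e * s e a * s a b + s d e * s e a * s a b * s b c
       + s e a * s a b * s b c * s c d))"
      unfolding anti[of a b] anti[of b c] anti[of c d] anti[of d e] anti[of e a]
      by (simp add: field_simps)
  qed
  also have "\<dots> = (120 * real (card (pverts T) choose 5) + 5 * path_sum2 + 5 * path_sum4) / 16"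
  proof -
    have "tsum (\<lambda>a b c d e. 1) = 120 * real (card (pverts T) choose 5)"
      using card_tuples5[OF pair_finite_verts] by (simp add: case_prod_unfold)
    moreover have "tsum (\<lambda>a b c d e. s a b * s b c + s b c * s c d + s c d * s d e + s d e * s e a
        + s e a * s a b) = 5 * path_sum2"
      using tsum_cyclic[of "\<lambda>a b c d e. s a b * s b c"] by (simp only: path_sum2_def s_def)
    moreover have "tsum (\<lambda>a b c d e. s a b * s c d + s b c * s d e + s c d * s e a + s d e * s a b
        + s e a * s b c) = 0"
      using tsum_cyclic[of "\<lambda>a b c d e. s a b * s c d"]
      by (simp only: s_def tsum_disjoint_arcs mult_zero_right)
    moreover have "tsum (\<lambda>a b c d e. s a b * s b c * s c d * s d e + s b c * s c d * s d e * s e a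
        + s c d * s d e * s e a * s a b + s d e * s e a * s a b * s b c
        + s e a * s a b * s b c * s c d) = 5 * path_sum4"
      using tsum_cyclic[of "\<lambda>a b c d e. s a b * s b c * s c d * s d e"]
      by (simp only: path_sum4_def s_def)
    \<comment> \<open>The instantiations of \<open>tsum_add\<close> split the sum only between the
      four groups, so each group still matches its evaluated sum.\<close>
    ultimately show ?thesis
      by (simp only: tsum_cmult tsum_add[of "\<lambda>a b c d e. _ a b c d e + _ a b c d e"]
        tsum_add[of "\<lambda>a b c d e. 1 + _ a b c d e"] tsum_add[of "\<lambda>a b c d e. 1"]) simp
  qed
  finally show ?thesis using card by simp
qed

section \<open>Edge scores: the two edge sums of the theorem, merged over the common factor
  -1/8\<close>

definition edge_term :: "'a \<Rightarrow> 'a \<Rightarrow> real" where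
  "edge_term u v =
    (let A = real (edge_score_A T u v); B = real (edge_score_B T u v);
         C = real (edge_score_C T u v); D = real (edge_score_D T u v)
     in (C + D) * (A - B)\<^sup>2 + (A + B) * (C - D)\<^sup>2 - 2 * ((A + B) * (C + D)))"

text \<open>Reversing the edge fixes \<open>A\<close> and \<open>B\<close> and exchanges
  \<open>C\<close> and \<open>D\<close>, which enter only through \<open>C + D\<close> and the
  square of \<open>C - D\<close>.\<close>

lemma edge_term_commute: "edge_term v u = edge_term u v"
proof -
  have "edge_score_A T v u = edge_score_A T u v" "edge_score_B T v u = edge_score_B T u v"
    "edge_score_C T v u = edge_score_D T u v" "edge_score_D T v u = edge_score_C T u v"
    unfolding edge_score_A_def edge_score_B_def edge_score_C_def edge_score_D_def
    by (auto intro!: arg_cong[of _ _ card])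
  then show ?thesis
    by (simp add: edge_term_def Let_def power2_eq_square algebra_simps)
qed

text \<open>Stated for every ordered pair of distinct vertices, not only for arcs, so that it can be
  summed over all choices of the first two entries of a 5-tuple.\<close>

lemma edge_term_eq:
  assumes uv: "u \<in> pverts T" "v \<in> pverts T" "u \<noteq> v"
  defines "W \<equiv> pverts T - {u, v}"
  shows "edge_term u v = (\<Sum>w\<in>W. \<Sum>x\<in>W-{w}. \<Sum>y\<in>W-{w,x}.
    ((arc_sign u w * arc_sign u x + arc_sign v w * arc_sign v x)
      - (arc_sign u w * arc_sign v x + arc_sign v w * arc_sign u x) * (arc_sign u y * arc_sign v y)) / 4)"
proof -
  let ?s = arc_sign
  \<comment> \<open>\<open>g1\<close> is 1 on the vertices counted by \<open>A\<close>, -1 on those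
    of \<open>B\<close> and 0 elsewhere; \<open>g2\<close> does the same for \<open>C\<close> and
    \<open>D\<close>. \<open>h1\<close> is the indicator of the vertices of \<open>C\<close> or
    \<open>D\<close>, \<open>h2\<close> that of \<open>A\<close> or \<open>B\<close>.\<close>
  define g1 where "g1 w = (?s u w + ?s v w) / 2" for w
  define g2 where "g2 w = (?s u w - ?s v w) / 2" for w
  define h1 where "h1 w = (1 - ?s u w * ?s v w) / 2" for w
  define h2 where "h2 w = (1 + ?s u w * ?s v w) / 2" for w
  note defs = g1_def g2_def h1_def h2_def
  have fin: "finite W"
    unfolding W_def using pair_finite_verts by simp
  have card: "real (card {w \<in> W. P w}) = (\<Sum>w\<in>W. of_bool (P w))" for P
    using fin by (simp add: sum.If_cases of_bool_def Int_def)
  have sign: "?s u w \<in> {1, -1}" "?s v w \<in> {1, -1}" if "w \<in> W" for w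
    using that uv exactly_one_arc[of u w] exactly_one_arc[of v w]
    by (auto simp: arc_sign_def W_def)
  have arcs: "of_bool ((u, w) \<in> parcs T) = (1 + ?s u w) / 2" "of_bool ((v, w) \<in> parcs T) = (1 + ?s v w) / 2"
    "of_bool ((w, u) \<in> parcs T) = (1 - ?s u w) / 2" "of_bool ((w, v) \<in> parcs T) = (1 - ?s v w) / 2"
    if "w \<in> W" for w
    using that uv exactly_one_arc[of u w] exactly_one_arc[of v w]
    by (auto simp: arc_sign_def W_def)
  note scores = edge_score_A_def edge_score_B_def edge_score_C_def edge_score_D_def
  define A B C D where "A = real (edge_score_A T u v)" and "B = real (edge_score_B T u v)"
    and "C = real (edge_score_C T u v)" and "D = real (edge_score_D T u v)"
  note ABCD = A_def B_def C_def D_def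
  have A: "A = (\<Sum>w\<in>W. (1 + ?s u w) / 2 * ((1 + ?s v w) / 2))"
    and B: "B = (\<Sum>w\<in>W. (1 - ?s u w) / 2 * ((1 - ?s v w) / 2))"
    and C: "C = (\<Sum>w\<in>W. (1 + ?s u w) / 2 * ((1 - ?s v w) / 2))"
    and D: "D = (\<Sum>w\<in>W. (1 - ?s u w) / 2 * ((1 + ?s v w) / 2))"
    unfolding ABCD scores W_def[symmetric] card of_bool_conj
    by (intro sum.cong refl; simp only: arcs)+
  have "A - B = sum g1 W" "A + B = sum h2 W" "C - D = sum g2 W" "C + D = sum h1 W"
    unfolding A B C D sum_subtractf[symmetric] sum.distrib[symmetric]
    by (intro sum.cong refl; simp add: defs field_simps)+
  moreover have "sum h2 W = (\<Sum>w\<in>W. (g1 w)\<^sup>2)" "sum h1 W = (\<Sum>w\<in>W. (g2 w)\<^sup>2)"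
    using sign by (fastforce simp: defs intro!: sum.cong)+
  \<comment> \<open>The correction is split evenly: since \<open>A + B\<close> is the sum of the
    squares of \<open>g1\<close>, and \<open>C + D\<close> that of \<open>g2\<close>, each product
    has the shape of \<open>sum_distinct_triples\<close>.\<close>
  moreover have "edge_term u v = ((A - B)\<^sup>2 - (A + B)) * (C + D) + ((C - D)\<^sup>2 - (C + D)) * (A + B)"
    by (simp add: edge_term_def Let_def ABCD algebra_simps)
  moreover have "g1 w * h1 w = 0" "g2 w * h2 w = 0" if "w \<in> W" for w
    using sign[OF that] by (auto simp: defs)
  ultimately have "edge_term u v =
      (\<Sum>w\<in>W. \<Sum>x\<in>W-{w}. \<Sum>y\<in>W-{w,x}. g1 w * g1 x * h1 y) +
      (\<Sum>w\<in>W. \<Sum>x\<in>W-{w}. \<Sum>y\<in>W-{w,x}. g2 w * g2 x * h2 y)"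
    using fin by (simp add: sum_distinct_triples)
  also have "\<dots> = (\<Sum>w\<in>W. \<Sum>x\<in>W-{w}. \<Sum>y\<in>W-{w,x}. g1 w * g1 x * h1 y + g2 w * g2 x * h2 y)"
    by (simp only: sum.distrib)
  finally show ?thesis
    by (rule trans) (intro sum.cong refl, simp add: defs field_simps)
qed

lemma sum_edge_term: "(\<Sum>(u, v)\<in>parcs T. edge_term u v) = - (path_sum2 + path_sum4) / 4"
proof -
  let ?V = "pverts T"
  define s where "s = arc_sign"
  \<comment> \<open>Symmetrising replaces arcs by all ordered pairs of distinct vertices, at the
    price of a factor 2.\<close>
  have "(\<Sum>(u, v)\<in>parcs T. edge_term u v) = (\<Sum>(u, v)\<in>(parcs T)\<inverse>. edge_term u v)"
    by (rule sum.reindex_bij_witness[where i = prod.swap and j = prod.swap])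
       (auto simp: edge_term_commute)
  then have "2 * (\<Sum>(u, v)\<in>parcs T. edge_term u v) =
      (\<Sum>(u, v)\<in>parcs T. edge_term u v) + (\<Sum>(u, v)\<in>(parcs T)\<inverse>. edge_term u v)"
    by simp
  also have "\<dots> = (\<Sum>(u, v)\<in>parcs T \<union> (parcs T)\<inverse>. edge_term u v)"
  proof (intro sum.union_disjoint[symmetric])
    have "(v, u) \<notin> parcs T" if "(u, v) \<in> parcs T" for u v
      using that exactly_one_arc[of u v] wellformed'[OF that] pair_no_loops[OF that] by auto
    then show "parcs T \<inter> (parcs T)\<inverse> = {}"
      by auto
  qed simp_all
  also have "parcs T \<union> (parcs T)\<inverse> = (SIGMA u:?V. ?V - {u})"
    using exactly_one_arc by (auto dest: wellformed' pair_no_loops)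
  also have "(\<Sum>(u, v)\<in>(SIGMA u:?V. ?V - {u}). edge_term u v) = (\<Sum>u\<in>?V. \<Sum>v\<in>?V-{u}. edge_term u v)"
    using pair_finite_verts by (simp add: sum.Sigma)
  also have "\<dots> = tsum (\<lambda>u v w x y. ((s u w * s u x + s v w * s v x)
      - (s u w * s v x + s v w * s u x) * (s u y * s v y)) / 4)"
    unfolding sum_tuples5[OF pair_finite_verts] s_def
  proof (intro sum.cong refl)
    fix u v assume "u \<in> ?V" "v \<in> ?V - {u}"
    then have *: "u \<in> ?V" "v \<in> ?V" "u \<noteq> v" by auto
    have "?V - {u, v} - {w} = ?V - {u, v, w}" "?V - {u, v} - {w, x} = ?V - {u, v, w, x}" for w x
      by auto
    then show "edge_term u v = (\<Sum>w\<in>?V-{u,v}. \<Sum>x\<in>?V-{u,v,w}. \<Sum>y\<in>?V-{u,v,w,x}.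
      ((arc_sign u w * arc_sign u x + arc_sign v w * arc_sign v x)
      - (arc_sign u w * arc_sign v x + arc_sign v w * arc_sign u x) * (arc_sign u y * arc_sign v y)) / 4)"
      using edge_term_eq[OF *] by simp
  qed
  \<comment> \<open>Signs are reoriented to read along the paths w-u-x, w-v-x, w-u-y-v-x and
    w-v-y-u-x. The short ones need one flip; the long ones need two and keep their minus
    sign.\<close>
  also have "\<dots> = tsum (\<lambda>u v w x y. (- 1 / 4) * (s w u * s u x + s w v * s v x
      + s w u * s u y * s y v * s v x + s w v * s v y * s y u * s u x))"
  proof (intro sum.cong refl, clarify)
    fix u v w x y
    have "s w u = - s u w" "s w v = - s v w" "s y v = - s v y" "s y u = - s u y"
      unfolding s_def by (rule arc_sign_antisym)+
    then show "((s u w * s u x + s v w * s v x)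
        - (s u w * s v x + s v w * s u x) * (s u y * s v y)) / 4 =
      (- 1 / 4) * (s w u * s u x + s w v * s v x
        + s w u * s u y * s y v * s v x + s w v * s v y * s y u * s u x)"
      by (simp add: field_simps)
  qed
  also have "\<dots> = - (path_sum2 + path_sum4) / 2"
  proof -
    \<comment> \<open>The witness \<open>j\<close> lists the vertices of the path first, in path
      order; the other two paths follow by swapping \<open>u\<close> and \<open>v\<close>.\<close>
    have "tsum (\<lambda>u v w x y. s w u * s u x) = path_sum2"
      unfolding path_sum2_def s_def
      by (rule sum.reindex_bij_witness[where i = "\<lambda>(a, b, c, d, e). (b, d, a, c, e)"
          and j = "\<lambda>(u, v, w, x, y). (w, u, x, v, y)"]) (auto simp: tuples5_def)
    moreover have "tsum (\<lambda>u v w x y. s w u * s u y * s y v * s v x) = path_sum4"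
      unfolding path_sum4_def s_def
      by (rule sum.reindex_bij_witness[where i = "\<lambda>(a, b, c, d, e). (b, d, a, e, c)"
          and j = "\<lambda>(u, v, w, x, y). (w, u, y, v, x)"]) (auto simp: tuples5_def)
    ultimately show ?thesis
      using sum_tuples5_swap[of "\<lambda>u v w x y. s w u * s u x" ?V]
        sum_tuples5_swap[of "\<lambda>u v w x y. s w u * s u y * s y v * s v x" ?V]
      unfolding tsum_cmult tsum_add by (simp add: field_simps)
  qed
  finally show ?thesis by simp
qed

end

theorem theorem2p1:
  fixes T :: "'a pair_pre_digraph" and n :: nat
  assumes "tournament T" and "card (pverts T) = n"
  shows "real (num_cycles T 5) =
    3 / 4 * real (n choose 5)
    - 1 / 8 * (\<Sum>(u, v)\<in>parcs T.
        let A = real (edge_score_A T u v); B = real (edge_score_B T u v);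
            C = real (edge_score_C T u v); D = real (edge_score_D T u v)
        in (C + D) * (A - B)^2 + (A + B) * (C - D)^2)
    + 1 / 4 * (\<Sum>(u, v)\<in>parcs T.
        let A = real (edge_score_A T u v); B = real (edge_score_B T u v);
            C = real (edge_score_C T u v); D = real (edge_score_D T u v)
        in (A + B) * (C + D))"
    (is "_ = _ - 1 / 8 * ?S + 1 / 4 * ?R")
proof -
  interpret tournament T by fact
  have "?S - 2 * ?R = (\<Sum>(u, v)\<in>parcs T. edge_term u v)"
    unfolding sum_distrib_left sum_subtractf[symmetric]
    by (intro sum.cong refl) (simp add: edge_term_def Let_def case_prod_unfold)
  moreover have "5 * real (num_cycles T 5) =
      (120 * real (n choose 5) + 5 * path_sum2 + 5 * path_sum4) / 32"
    using card_cycles5_eq card_cycles5 assms(2) by simp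
  \<comment> \<open>After division by 5 the constant is 120/160 = 3/4, and the path sums carry 1/32,
    which is -1/8 times the -1/4 of \<open>sum_edge_term\<close>.\<close>
  ultimately show ?thesis
    unfolding sum_edge_term by simp
qed

end
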